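(* Let $n\ge 2$, let $L>0$ be a scalar, $x_{k-1}\in\mathbb{R}^n$ a point, and $g\in\mathbb{R}^n$ a nonzero vector. Define $\bar x_{k-1}=x_{k-1}-g/L$. Let $\Lambda\subset\mathbb{R}^n$ be a line containing $\bar x_{k-1}$ but not $x_{k-1}$, and let $x_k\in\Lambda$ be a point. Let $\mathcal{M}_k=\mathrm{aff}\{\Lambda,x_{k-1}\}$. Assume that $g^T(x_k-\bar x_{k-1})<0$. Define $\mathcal{F}$ to be the set of functions $f:\mathbb{R}^n\to\mathbb{R}$ such that - $f$ is convex, - $\mathrm{argmin}\{f(x):x\in\Lambda\}=x_k$, - $\nabla f$ is $L$-Lipschitz, - $\nabla f(x_{k-1})=g$. Define $q(x)=\sup\{f(x)-f(x_{k-1}):f\in\mathcal{F}\}$. Then $$q(x_k)=\min\{q(x):x\in\mathcal{M}_k\}.$$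
   Context: $\mathrm{aff}\{\Lambda,x_{k-1}\}$ is the affine hull of $\Lambda\cup\{x_{k-1}\}$. The condition $\mathrm{argmin}\{f(x):x\in\Lambda\}=x_k$ means that $x_k$ is the unique minimizer of $f$ on $\Lambda$. The index $k$ only labels the given data. *)

theory Defs
  imports "HOL-Analysis.Analysis"
begin

definition is_line :: "'a::euclidean_space set \<Rightarrow> bool" where
  "is_line S \<longleftrightarrow> affine S \<and> aff_dim S = 1"

definition argmin_set :: "('a \<Rightarrow> 'b::ord) \<Rightarrow> 'a set \<Rightarrow> 'a set" where
  "argmin_set f S = {y. is_arg_min f (\<lambda>x. x \<in> S) y}"

text \<open>Here \<open>x0\<close> is the point \<open>x\<^bsub>k-1\<^esub>\<close> and \<open>x1\<close> is \<open>x\<^bsub>k\<^esub>\<close>. The function \<open>G\<close> is the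
  gradient of \<open>f\<close>, which is uniquely determined by \<open>f\<close>.\<close>

definition fun_class ::
  "real \<Rightarrow> 'a::euclidean_space \<Rightarrow> 'a \<Rightarrow> 'a set \<Rightarrow> 'a \<Rightarrow> ('a \<Rightarrow> real) set" where
  "fun_class L x0 g \<Lambda> x1 =
    {f. convex_on UNIV f \<and>
        argmin_set f \<Lambda> = {x1} \<and>
        (\<exists>G. (\<forall>x. GDERIV f x :> G x) \<and> L-lipschitz_on UNIV G \<and> G x0 = g)}"

text \<open>The supremum is taken in the extended reals, so that it needs no side conditions
  of nonemptiness or boundedness.\<close>

definition worst_case ::
  "real \<Rightarrow> 'a::euclidean_space \<Rightarrow> 'a \<Rightarrow> 'a set \<Rightarrow> 'a \<Rightarrow> 'a \<Rightarrow> ereal" where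
  "worst_case L x0 g \<Lambda> x1 x = (SUP f\<in>fun_class L x0 g \<Lambda> x1. ereal (f x - f x0))"

text \<open>The library's \<open>Min\<close> is meaningful for finite sets only.\<close>

definition is_minimum :: "'a::order \<Rightarrow> 'a set \<Rightarrow> bool" where
  "is_minimum m A \<longleftrightarrow> m \<in> A \<and> (\<forall>a\<in>A. m \<le> a)"

end

theory Submission
  imports Defs
begin

text \<open>No \<open>f\<close> in the class exceeds \<open>f x0 - \<bar>g\<bar>\<^sup>2 / (2 L)\<close> at \<open>x1\<close>: the gradient step
  from \<open>x0\<close> to \<open>xbar\<close> decreases \<open>f\<close> by at least \<open>\<bar>g\<bar>\<^sup>2 / (2 L)\<close>, and \<open>x1\<close> is at least as
  good as \<open>xbar\<close>. Conversely, for every tolerance some \<open>f\<close> in the class stays above that level,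
  up to the tolerance, on the whole space: take \<open>L\<close> times the Moreau envelope of the function
  that is infinite off the segment from \<open>xbar\<close> to \<open>x1\<close> and decreases linearly along it with
  small slope. Because \<open>g \<bullet> (x1 - xbar) < 0\<close> strictly, a small slope leaves the proximal point
  of \<open>x0\<close> at \<open>xbar\<close>, hence the gradient at \<open>x0\<close> equal to \<open>g\<close>, while it makes \<open>x1\<close> the unique
  minimizer. Up to a constant, this envelope is \<open>\<bar>x + e - P (x + e)\<bar>\<^sup>2 / 2 - e \<bullet> x\<close> with \<open>P\<close>
  the projection onto the segment and \<open>e\<close> a small multiple of \<open>x1 - xbar\<close>.\<close>

section \<open>First-order bounds for convex and smooth functions\<close>

lemma lipschitz_gradient_descent:
  fixes f :: "'a::real_inner \<Rightarrow> real"
  assumes G: "\<And>x. GDERIV f x :> G x" and lip: "L-lipschitz_on UNIV G"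
  shows "f y \<le> f x + G x \<bullet> (y - x) + L / 2 * (norm (y - x))\<^sup>2"
proof -
  define h where "h = y - x"
  \<comment> \<open>Along the segment, subtract the linear part and the quadratic allowance. The
    gradient changes by at most \<open>L * (t * norm h)\<close>, so by Cauchy-Schwarz \<phi> cannot
    increase.\<close>
  define \<phi> where "\<phi> = (\<lambda>t::real. f (x + t *\<^sub>R h) - t * (G x \<bullet> h) - L / 2 * t\<^sup>2 * (norm h)\<^sup>2)"
  have "\<phi> 0 \<ge> \<phi> 1"
  proof (rule DERIV_nonpos_imp_nonincreasing[where f = \<phi>])
    fix t :: real
    assume t: "0 \<le> t"
    have "((\<lambda>t. f (x + t *\<^sub>R h)) has_derivative (\<lambda>s. (s *\<^sub>R h) \<bullet> G (x + t *\<^sub>R h))) (at t)"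
      by (rule has_derivative_compose[of "\<lambda>t. x + t *\<^sub>R h" "\<lambda>s. s *\<^sub>R h" t UNIV f, OF _ G[unfolded gderiv_def]])
        (auto intro!: derivative_eq_intros)
    then have "((\<lambda>t. f (x + t *\<^sub>R h)) has_real_derivative (G (x + t *\<^sub>R h) \<bullet> h)) (at t)"
      by (simp add: has_field_derivative_def inner_commute mult_commute_abs)
    then have D: "(\<phi> has_real_derivative (G (x + t *\<^sub>R h) \<bullet> h - G x \<bullet> h - L * t * (norm h)\<^sup>2)) (at t)"
      unfolding \<phi>_def by (auto intro!: derivative_eq_intros)
    have "G (x + t *\<^sub>R h) \<bullet> h - G x \<bullet> h \<le> norm (G (x + t *\<^sub>R h) - G x) * norm h"
      using norm_cauchy_schwarz[of "G (x + t *\<^sub>R h) - G x" h] by (simp add: inner_diff_left)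
    also have "\<dots> \<le> (L * (t * norm h)) * norm h"
      using lipschitz_on_normD[OF lip, of "x + t *\<^sub>R h" x] t by (intro mult_right_mono) auto
    finally have "G (x + t *\<^sub>R h) \<bullet> h - G x \<bullet> h - L * t * (norm h)\<^sup>2 \<le> 0"
      by (simp add: power2_eq_square mult.assoc)
    with D show "\<exists>y. (\<phi> has_real_derivative y) (at t) \<and> y \<le> 0"
      by blast
  qed simp
  then show ?thesis
    by (simp add: \<phi>_def h_def)
qed

text \<open>Average the two inequalities based at the convex combination \<open>z\<close>: their
  linear terms cancel.\<close>

lemma convex_on_UNIV_if_subgradients:
  fixes f :: "'a::real_inner \<Rightarrow> real"
  assumes sub: "\<And>x y. f x + (y - x) \<bullet> G x \<le> f y"
  shows "convex_on UNIV f"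
proof
  fix t :: real and x y :: 'a
  assume t: "0 < t" "t < 1"
  define z where "z = (1 - t) *\<^sub>R x + t *\<^sub>R y"
  have "(1 - t) * (f z + (x - z) \<bullet> G z) + t * (f z + (y - z) \<bullet> G z) \<le> (1 - t) * f x + t * f y"
    using t sub by (intro add_mono mult_left_mono) auto
  moreover have "(1 - t) * ((x - z) \<bullet> G z) + t * ((y - z) \<bullet> G z) = 0"
    by (simp add: z_def algebra_simps)
  ultimately show "f ((1 - t) *\<^sub>R x + t *\<^sub>R y) \<le> (1 - t) * f x + t * f y"
    by (simp add: z_def algebra_simps)
qed simp

lemma GDERIV_if_quadratic_bound:
  fixes f :: "'a::real_inner \<Rightarrow> real"
  assumes bound: "\<And>y. \<bar>f y - f x - (y - x) \<bullet> v\<bar> \<le> K * (norm (y - x))\<^sup>2"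
  shows "GDERIV f x :> v"
  unfolding gderiv_def
proof (rule has_derivativeI_sandwich[where e = 1 and H = "\<lambda>y. K * norm (y - x)"])
  show "bounded_linear (\<lambda>h. h \<bullet> v)"
    by (rule bounded_linear_inner_left)
  show "norm (f y - f x - (y - x) \<bullet> v) / norm (y - x) \<le> K * norm (y - x)" if "y \<noteq> x" for y
    using bound[of y] that by (simp add: divide_le_eq power2_eq_square mult.assoc)
  show "((\<lambda>y. K * norm (y - x)) \<longlongrightarrow> 0) (at x)"
    by (auto intro!: tendsto_eq_intros)
qed simp

section \<open>Projections and the squared distance to a closed convex set\<close>

lemma closest_point_eqI:
  fixes C :: "'a::euclidean_space set"
  assumes "convex C" "closed C" "p \<in> C" and le: "\<And>z. z \<in> C \<Longrightarrow> (a - p) \<bullet> (z - p) \<le> 0"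
  shows "closest_point C a = p"
proof -
  have "dist a p \<le> dist a z" if "z \<in> C" for z
  proof -
    have "(a - z) \<bullet> (a - z) = (a - p) \<bullet> (a - p) - 2 * ((a - p) \<bullet> (z - p)) + (z - p) \<bullet> (z - p)"
      by (simp add: algebra_simps inner_commute)
    then show ?thesis
      using le[OF that] inner_ge_zero[of "z - p"] unfolding dist_norm norm_le by linarith
  qed
  with assms show ?thesis
    by (metis closest_point_unique)
qed

context
  fixes C :: "'a::euclidean_space set"
  assumes C: "convex C" "closed C" "C \<noteq> {}"
begin

text \<open>The gap between the two sides is half a square minus
  \<open>(x - p) \<bullet> (q - p)\<close>, and that inner product is nonpositive by the
  obtuse-angle property of the projection.\<close>

lemma half_sq_dist_lower:
  "(norm (x - closest_point C x))\<^sup>2 / 2 + (y - x) \<bullet> (x - closest_point C x)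
    \<le> (norm (y - closest_point C y))\<^sup>2 / 2"
proof -
  define p q where "p = closest_point C x" and "q = closest_point C y"
  have "(x - p) \<bullet> (q - p) \<le> 0"
    unfolding p_def q_def using C by (intro closest_point_dot closest_point_in_set)
  moreover have "(y - q) \<bullet> (y - q) / 2 - (x - p) \<bullet> (x - p) / 2 - (y - x) \<bullet> (x - p)
      = (y - q - (x - p)) \<bullet> (y - q - (x - p)) / 2 - (x - p) \<bullet> (q - p)"
    by (simp add: algebra_simps inner_commute add_divide_distrib diff_divide_distrib)
  ultimately show ?thesis
    using inner_ge_zero[of "y - q - (x - p)"]
    unfolding power2_norm_eq_inner p_def[symmetric] q_def[symmetric] by linarith
qed

text \<open>The projection \<open>p\<close> of \<open>x\<close> competes for the distance from
  \<open>y\<close>; the right-hand side is exactly half the squared distance from \<open>y\<close>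
  to \<open>p\<close>.\<close>

lemma half_sq_dist_upper:
  "(norm (y - closest_point C y))\<^sup>2 / 2
    \<le> (norm (x - closest_point C x))\<^sup>2 / 2 + (y - x) \<bullet> (x - closest_point C x)
      + (norm (y - x))\<^sup>2 / 2"
proof -
  define p where "p = closest_point C x"
  have "norm (y - closest_point C y) \<le> norm (y - p)"
    using C closest_point_le[of C p y] closest_point_in_set[of C x] by (simp add: p_def dist_norm)
  then have "(norm (y - closest_point C y))\<^sup>2 \<le> (norm (y - p))\<^sup>2"
    by (rule power_mono) simp
  moreover have "(y - p) \<bullet> (y - p) / 2
      = (x - p) \<bullet> (x - p) / 2 + (y - x) \<bullet> (x - p) + (y - x) \<bullet> (y - x) / 2"
    by (simp add: algebra_simps inner_commute add_divide_distrib diff_divide_distrib)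
  ultimately show ?thesis
    by (simp add: p_def power2_norm_eq_inner)
qed

text \<open>Firm nonexpansiveness: the obtuse-angle inequalities at \<open>p\<close> and at
  \<open>q\<close> make every term dropped from the expansion of
  \<open>(x - y) \<bullet> (x - y)\<close> nonnegative.\<close>

lemma lipschitz_sub_closest_point: "1-lipschitz_on UNIV (\<lambda>x. x - closest_point C x)"
proof (rule lipschitz_onI)
  fix x y
  define p q where "p = closest_point C x" and "q = closest_point C y"
  have "(x - p) \<bullet> (q - p) \<le> 0" "(y - q) \<bullet> (p - q) \<le> 0"
    unfolding p_def q_def using C by (intro closest_point_dot closest_point_in_set; simp)+
  moreover have "(x - y) \<bullet> (x - y) = (x - p - (y - q)) \<bullet> (x - p - (y - q))
      + (p - q) \<bullet> (p - q) - 2 * ((x - p) \<bullet> (q - p)) - 2 * ((y - q) \<bullet> (p - q))"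
    by (simp add: algebra_simps inner_commute)
  ultimately show "dist (x - closest_point C x) (y - closest_point C y) \<le> 1 * dist x y"
    using inner_ge_zero[of "p - q"] by (simp add: dist_norm norm_le flip: p_def q_def)
qed simp

text \<open>Hiding the tilt in the shift by \<open>e\<close> reduces everything to plain
  projections.\<close>

definition tilted_sq_dist :: "real \<Rightarrow> 'a \<Rightarrow> 'a \<Rightarrow> real" where
  "tilted_sq_dist L e x = L * ((norm (x + e - closest_point C (x + e)))\<^sup>2 / 2 - e \<bullet> x)"

text \<open>Scale and translate the bounds for the half squared distance. The linear term
  contributes \<open>- L *\<^sub>R e\<close> to the gradient, which cancels the shift.\<close>

lemma
  assumes "L > 0"
  shows convex_tilted_sq_dist: "convex_on UNIV (tilted_sq_dist L e)"
    and GDERIV_tilted_sq_dist: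
      "GDERIV (tilted_sq_dist L e) x :> L *\<^sub>R (x - closest_point C (x + e))"
    and lipschitz_tilted_sq_dist_gradient:
      "L-lipschitz_on UNIV (\<lambda>x. L *\<^sub>R (x - closest_point C (x + e)))"
proof -
  let ?f = "tilted_sq_dist L e"
  let ?G = "\<lambda>x. L *\<^sub>R (x - closest_point C (x + e))"
  have grad: "(y - x) \<bullet> ?G x
      = L * ((y - x) \<bullet> (x + e - closest_point C (x + e)) - (e \<bullet> y - e \<bullet> x))" for x y
    by (simp add: algebra_simps inner_commute)
  have lower: "?f x + (y - x) \<bullet> ?G x \<le> ?f y" for x y
    using mult_left_mono[OF half_sq_dist_lower[of "x + e" "y + e"], of L] assms
    unfolding tilted_sq_dist_def grad by (simp add: distrib_left right_diff_distrib)
  have upper: "?f y \<le> ?f x + (y - x) \<bullet> ?G x + L / 2 * (norm (y - x))\<^sup>2" for x y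
    using mult_left_mono[OF half_sq_dist_upper[of "y + e" "x + e"], of L] assms
    unfolding tilted_sq_dist_def grad by (simp add: distrib_left right_diff_distrib)
  show "convex_on UNIV ?f"
    using lower by (rule convex_on_UNIV_if_subgradients)
  show "GDERIV ?f x :> ?G x"
    using lower[of x] upper[of _ x] by (intro GDERIV_if_quadratic_bound[where K = "L / 2"]) (smt (verit))
  have "(L * (1 * 1))-lipschitz_on UNIV (\<lambda>x. L *\<^sub>R (x + e - closest_point C (x + e)))"
    using assms by (intro lipschitz_on_cmult_nonneg lipschitz_on_compose2[where f = "\<lambda>x. x + e"]
        lipschitz_on_subset[OF lipschitz_sub_closest_point]) (auto intro!: lipschitz_onI)
  \<comment> \<open>The two maps differ by the constant \<open>L *\<^sub>R e\<close>.\<close>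
  then show "L-lipschitz_on UNIV ?G"
    by (simp add: lipschitz_on_def dist_norm algebra_simps)
qed

text \<open>Expanding the square moves the tilt from \<open>x\<close> to its proximal point, a form
  from which values and minimizers can be read off.\<close>

lemma tilted_sq_dist_eq:
  "tilted_sq_dist L e x = L * ((norm (x - closest_point C (x + e)))\<^sup>2 / 2
      - e \<bullet> closest_point C (x + e) + (norm e)\<^sup>2 / 2)"
proof -
  define p where "p = closest_point C (x + e)"
  have "(x + e - p) \<bullet> (x + e - p) / 2 - e \<bullet> x = (x - p) \<bullet> (x - p) / 2 - e \<bullet> p + e \<bullet> e / 2"
    by (simp add: algebra_simps inner_commute add_divide_distrib diff_divide_distrib)
  then show ?thesis
    by (simp add: tilted_sq_dist_def p_def power2_norm_eq_inner)
qed

end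

section \<open>Near-extremal members of the class, and the guaranteed decrease\<close>

lemma fun_class_almost_above:
  fixes x0 x1 g :: "'a::euclidean_space"
  assumes L: "L > 0" and xbar: "xbar = x0 - g /\<^sub>R L" and x1: "x1 \<in> \<Lambda>"
    and neg: "g \<bullet> (x1 - xbar) < 0" and \<epsilon>: "\<epsilon> > 0"
  obtains f where "f \<in> fun_class L x0 g \<Lambda> x1"
    and "\<And>x. f x - f x0 \<ge> - (norm g)\<^sup>2 / (2 * L) - \<epsilon>"
proof -
  define d where "d = x1 - xbar"
  have "d \<noteq> 0" and gd: "g \<bullet> d < 0"
    using neg by (auto simp: d_def)
  then have dd: "d \<bullet> d > 0"
    by simp
  define C where "C = closed_segment xbar x1"
  have C: "convex C" "closed C" "C \<noteq> {}"
    by (auto simp: C_def)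
  have C_iff: "z \<in> C \<longleftrightarrow> (\<exists>t. 0 \<le> t \<and> t \<le> 1 \<and> z = xbar + t *\<^sub>R d)" for z
    unfolding C_def in_segment by (simp add: d_def algebra_simps)
  \<comment> \<open>With \<eta> zero, all of \<open>C\<close> would minimize. One cap keeps the
    projection of \<open>x0 + e\<close> at \<open>xbar\<close>; the other limits the loss
    \<open>L * (e \<bullet> d)\<close> to \<epsilon>.\<close>
  define \<eta> where "\<eta> = min (- (g \<bullet> d)) \<epsilon> / (L * (d \<bullet> d))"
  have \<eta>: "\<eta> > 0" "L * \<eta> * (d \<bullet> d) \<le> \<epsilon>" "L * \<eta> * (d \<bullet> d) \<le> - (g \<bullet> d)"
    using L dd gd \<epsilon> by (auto simp: \<eta>_def)
  define e where "e = \<eta> *\<^sub>R d"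
  \<comment> \<open>Moving on from the endpoint \<open>x1\<close> in direction \<open>d\<close>
    leaves its projection unchanged.\<close>
  have P1: "closest_point C (x1 + e) = x1"
  proof (rule closest_point_eqI[OF C(1,2)])
    fix z assume "z \<in> C"
    then obtain t where t: "t \<le> 1" "z = xbar + t *\<^sub>R d"
      unfolding C_iff by blast
    then have "z - x1 = - ((1 - t) *\<^sub>R d)"
      by (simp add: d_def algebra_simps)
    then have "(x1 + e - x1) \<bullet> (z - x1) = - (\<eta> * ((1 - t) * (d \<bullet> d)))"
      by (simp add: e_def)
    then show "(x1 + e - x1) \<bullet> (z - x1) \<le> 0"
      using \<eta>(1) t(1) dd by simp
  qed (simp add: C_def)
  have P0: "closest_point C (x0 + e) = xbar"
  proof (rule closest_point_eqI[OF C(1,2)])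
    fix z assume "z \<in> C"
    then obtain t where t: "0 \<le> t" "z = xbar + t *\<^sub>R d"
      unfolding C_iff by blast
    have "L * ((g /\<^sub>R L + e) \<bullet> d) = g \<bullet> d + L * \<eta> * (d \<bullet> d)"
      using L by (simp add: e_def algebra_simps)
    then have "L * ((g /\<^sub>R L + e) \<bullet> d) \<le> 0"
      using \<eta>(3) by simp
    then have "(g /\<^sub>R L + e) \<bullet> d \<le> 0"
      using L by (simp add: mult_le_0_iff)
    then have "t * ((g /\<^sub>R L + e) \<bullet> d) \<le> 0"
      using t(1) by (rule mult_nonneg_nonpos[rotated])
    then show "(x0 + e - xbar) \<bullet> (z - xbar) \<le> 0"
      by (simp add: t(2) xbar add.commute)
  qed (simp add: C_def)
  define f where "f = tilted_sq_dist C L e"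
  have f_eq: "f x = L * ((norm (x - closest_point C (x + e)))\<^sup>2 / 2
      - e \<bullet> closest_point C (x + e) + (norm e)\<^sup>2 / 2)" for x
    unfolding f_def by (rule tilted_sq_dist_eq[OF C])
  have f1: "f x1 = L * (- (e \<bullet> x1) + (norm e)\<^sup>2 / 2)"
    by (simp add: f_eq P1)
  have min: "f x1 \<le> f x" and uniq: "f x \<le> f x1 \<Longrightarrow> x = x1" for x
  proof -
    define p where "p = closest_point C (x + e)"
    have "p \<in> C"
      unfolding p_def using C by (intro closest_point_in_set)
    then obtain t where t: "t \<le> 1" "p = xbar + t *\<^sub>R d"
      unfolding C_iff by blast
    \<comment> \<open>Both summands are nonnegative; they vanish together only for
      \<open>x = p\<close> and \<open>t = 1\<close>, that is, at \<open>x1\<close>.\<close>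
    have diff: "f x - f x1 = L * ((norm (x - p))\<^sup>2 / 2 + (1 - t) * (\<eta> * (d \<bullet> d)))"
    proof -
      have "x1 - p = (1 - t) *\<^sub>R d"
        by (simp add: t(2) d_def algebra_simps)
      then have "e \<bullet> (x1 - p) = (1 - t) * (\<eta> * (d \<bullet> d))"
        by (simp add: e_def)
      then show ?thesis
        unfolding f1 f_eq[of x] p_def[symmetric] by (simp add: inner_diff_right flip: right_diff_distrib)
    qed
    have nonneg: "(1 - t) * (\<eta> * (d \<bullet> d)) \<ge> 0" "(norm (x - p))\<^sup>2 / 2 \<ge> 0"
      using t(1) \<eta>(1) by auto
    then have "0 \<le> L * ((norm (x - p))\<^sup>2 / 2 + (1 - t) * (\<eta> * (d \<bullet> d)))"
      using L by (intro mult_nonneg_nonneg) auto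
    with diff show "f x1 \<le> f x"
      by simp
    assume "f x \<le> f x1"
    with diff have "(norm (x - p))\<^sup>2 / 2 + (1 - t) * (\<eta> * (d \<bullet> d)) \<le> 0"
      using L by (metis diff_le_0_iff_le mult_le_0_iff not_less order_less_imp_le order.asym)
    with nonneg have "(norm (x - p))\<^sup>2 / 2 = 0" "(1 - t) * (\<eta> * (d \<bullet> d)) = 0"
      by linarith+
    with \<eta>(1) \<open>d \<noteq> 0\<close> show "x = x1"
      by (simp add: t(2) d_def)
  qed
  show thesis
  proof
    have "argmin_set f \<Lambda> = {x1}"
      using x1 min uniq by (fastforce simp: argmin_set_def is_arg_min_def not_less)
    moreover have "L *\<^sub>R (x0 - closest_point C (x0 + e)) = g"
      using L by (simp add: P0 xbar)
    ultimately show "f \<in> fun_class L x0 g \<Lambda> x1"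
      using convex_tilted_sq_dist[OF C L, of e] GDERIV_tilted_sq_dist[OF C L, of e]
        lipschitz_tilted_sq_dist_gradient[OF C L, of e]
      unfolding fun_class_def f_def
      by (intro CollectI conjI exI[of _ "\<lambda>x. L *\<^sub>R (x - closest_point C (x + e))"] allI)
    \<comment> \<open>The residual is \<open>g /\<^sub>R L\<close> at \<open>x0\<close> and zero at
      \<open>x1\<close>, while the proximal points differ by \<open>d\<close>.\<close>
    have "f x1 - f x0 = - (L * (norm (g /\<^sub>R L))\<^sup>2 / 2) - L * (e \<bullet> d)"
      unfolding f1 f_eq[of x0] P0 by (simp add: xbar d_def algebra_simps)
    also have "L * (norm (g /\<^sub>R L))\<^sup>2 / 2 = (norm g)\<^sup>2 / (2 * L)"
      using L by (simp add: power_mult_distrib power2_eq_square field_simps)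
    finally show "f x - f x0 \<ge> - (norm g)\<^sup>2 / (2 * L) - \<epsilon>" for x
      using min[of x] \<eta>(2) by (simp add: e_def mult.assoc)
  qed
qed

lemma fun_class_decrease:
  fixes x0 x1 g :: "'a::euclidean_space"
  assumes L: "L > 0" and xbar: "xbar = x0 - g /\<^sub>R L" "xbar \<in> \<Lambda>"
    and f: "f \<in> fun_class L x0 g \<Lambda> x1"
  shows "f x1 - f x0 \<le> - (norm g)\<^sup>2 / (2 * L)"
proof -
  obtain G where G: "\<And>x. GDERIV f x :> G x" "L-lipschitz_on UNIV G" "G x0 = g"
    and arg: "argmin_set f \<Lambda> = {x1}"
    using f unfolding fun_class_def by blast
  have "x1 \<in> argmin_set f \<Lambda>"
    using arg by simp
  then have "f x1 \<le> f xbar"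
    using xbar(2) by (auto simp: argmin_set_def is_arg_min_def not_less)
  also have "f xbar \<le> f x0 + g \<bullet> (xbar - x0) + L / 2 * (norm (xbar - x0))\<^sup>2"
    using lipschitz_gradient_descent[OF G(1,2), of xbar x0] G(3) by simp
  \<comment> \<open>The step is \<open>- g /\<^sub>R L\<close>, so the quadratic term gives back
    half of the linear decrease.\<close>
  also have "\<dots> = f x0 - (norm g)\<^sup>2 / (2 * L)"
    using L by (simp add: xbar(1) power_mult_distrib power2_eq_square field_simps
        flip: power2_norm_eq_inner)
  finally show ?thesis
    by simp
qed

theorem theorem4:
  fixes L :: real and x0 x1 g xbar :: "real ^ 'n"
    and \<Lambda> M :: "(real ^ 'n) set" and q :: "real ^ 'n \<Rightarrow> ereal"
  assumes "CARD('n) \<ge> 2"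
    and "L > 0"
    and "g \<noteq> 0"
    and "xbar = x0 - g /\<^sub>R L"
    and "is_line \<Lambda>"
    and "xbar \<in> \<Lambda>"
    and "x0 \<notin> \<Lambda>"
    and "x1 \<in> \<Lambda>"
    and "M = affine hull (\<Lambda> \<union> {x0})"
    and "g \<bullet> (x1 - xbar) < 0"
    and "q = worst_case L x0 g \<Lambda> x1"
  shows "is_minimum (q x1) {q x |x. x \<in> M}"
proof -
  have upper: "q x1 \<le> ereal (- (norm g)\<^sup>2 / (2 * L))"
    unfolding assms(11) worst_case_def
    using fun_class_decrease[OF assms(2,4,6)] by (intro SUP_least) simp
  \<comment> \<open>The same constant bounds \<open>q\<close> from below everywhere; the tolerance
    is removed in the limit.\<close>
  have lower: "ereal (- (norm g)\<^sup>2 / (2 * L)) \<le> q x" for x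
  proof (rule ereal_le_epsilon2)
    fix \<epsilon> :: real
    assume "\<epsilon> > 0"
    then obtain f where f: "f \<in> fun_class L x0 g \<Lambda> x1"
      and above: "f x - f x0 \<ge> - (norm g)\<^sup>2 / (2 * L) - \<epsilon>"
      using fun_class_almost_above[OF assms(2,4,8,10)] by metis
    have "ereal (- (norm g)\<^sup>2 / (2 * L)) \<le> ereal (f x - f x0) + ereal \<epsilon>"
      using above by simp
    also have "\<dots> \<le> q x + ereal \<epsilon>"
      unfolding assms(11) worst_case_def using f by (intro add_right_mono SUP_upper)
    finally show "ereal (- (norm g)\<^sup>2 / (2 * L)) \<le> q x + ereal \<epsilon>" .
  qed
  have "x1 \<in> M"
    using assms(8,9) by (simp add: hull_inc)
  then show ?thesis
    unfolding is_minimum_def using order_trans[OF upper lower] by blast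
qed

end
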